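(* Let $H$ be a real Hilbert space and let $K$ be a self-dual cone in $H$. If $T\in \mathcal{B}(H)$ is a self-adjoint operator such that $m_r(T) >0$, then for every solution $x \in R(T)$ of $LCP(T,b)$, where $b\in R(T)$, one has $$\|x\| \le \frac{M(T)}{m_r(T)}\, \|T^{\dagger} b\|.$$
   Context: $\mathcal{B}(H)$ is the set of bounded linear operators on $H$; $T^*$ is the adjoint of $T$ and $R(\cdot)$ denotes range. A subset $K\subseteq H$ is a cone if $x,y\in K$ and $\lambda\ge 0$ imply $x+y\in K$ and $\lambda x\in K$, and $K\cap(-K)=\{0\}$. Its dual cone is $K^*=\{y\in H: \langle y,x\rangle\ge 0 \text{ for all } x\in K\}$ (continuous linear functionals on $H$ being identified with vectors of $H$); $K$ is self-dual if $K=K^*$. The linear complementarity problem $LCP(T,b)$ (with respect to $K$) is to find $z\in K$ such that $Tz+b\in K^*$ and $\langle z,Tz+b\rangle=0$. Define $M(T)=\sup\{\langle Tx,x\rangle : x\in H,\ \|x\|=1\}$ and $m_r(T)=\inf\{\langle Tx,x\rangle : x\in R(T^* ),\ \|x\|=1\}$. The Moore-Penrose inverse $T^\dagger$ is the unique $S\in\mathcal{B}(H)$ with $TST=T$, $STS=S$, $(TS)^*=TS$, $(ST)^*=ST$; it exists if and only if $R(T)$ is closed, which is the case for self-adjoint $T$ with $m_r(T)>0$. *)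

theory Defs
  imports "HOL-Analysis.Analysis"
begin

definition is_cone :: "'a::real_inner set \<Rightarrow> bool" where
  "is_cone K \<longleftrightarrow>
     (\<forall>x\<in>K. \<forall>y\<in>K. x + y \<in> K) \<and>
     (\<forall>x\<in>K. \<forall>c::real. 0 \<le> c \<longrightarrow> c *\<^sub>R x \<in> K) \<and>
     K \<inter> uminus ` K = {0}"

definition dual_cone :: "'a::real_inner set \<Rightarrow> 'a set" where
  "dual_cone K = {y. \<forall>x\<in>K. 0 \<le> y \<bullet> x}"

definition self_dual_cone :: "'a::real_inner set \<Rightarrow> bool" where
  "self_dual_cone K \<longleftrightarrow> is_cone K \<and> dual_cone K = K"

definition solves_LCP :: "'a::real_inner set \<Rightarrow> ('a \<Rightarrow> 'a) \<Rightarrow> 'a \<Rightarrow> 'a \<Rightarrow> bool" where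
  "solves_LCP K T b z \<longleftrightarrow>
     z \<in> K \<and> T z + b \<in> dual_cone K \<and> z \<bullet> (T z + b) = 0"

(* Supremum and infimum are taken in the extended reals, so that they have their usual
   values (-\<infinity> and \<infinity>) when there is no unit vector in the set in question: for numrange_Sup
   on the zero space, and for numrange_Inf when T = 0. On a nonempty set of unit
   vectors both are finite for bounded T. *)

definition numrange_Sup :: "('a::real_inner \<Rightarrow> 'a) \<Rightarrow> ereal" where
  "numrange_Sup T = (SUP x\<in>{x. norm x = 1}. ereal (T x \<bullet> x))"

definition numrange_Inf :: "('a::real_inner \<Rightarrow> 'a) \<Rightarrow> ereal" where
  "numrange_Inf T = (INF x\<in>{x \<in> range (adjoint T). norm x = 1}. ereal (T x \<bullet> x))"

definition is_moore_penrose :: "('a::real_inner \<Rightarrow> 'a) \<Rightarrow> ('a \<Rightarrow> 'a) \<Rightarrow> bool" where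
  "is_moore_penrose T S \<longleftrightarrow>
     bounded_linear S \<and>
     T \<circ> S \<circ> T = T \<and> S \<circ> T \<circ> S = S \<and>
     adjoint (T \<circ> S) = T \<circ> S \<and> adjoint (S \<circ> T) = S \<circ> T"

definition moore_penrose :: "('a::real_inner \<Rightarrow> 'a) \<Rightarrow> 'a \<Rightarrow> 'a" where
  "moore_penrose T = (THE S. is_moore_penrose T S)"

end

theory Submission
  imports Defs
begin

text \<open>On the range of \<^term>\<open>T\<close> the form \<^term>\<open>\<lambda>x. T x \<bullet> x\<close> is bounded below by
  \<^term>\<open>m * (x \<bullet> x)\<close>, where \<^term>\<open>m\<close> is \<^term>\<open>numrange_Inf T\<close>; as \<^term>\<open>T\<close> vanishes on
  the orthogonal complement, the form is positive semidefinite everywhere. With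
  \<^term>\<open>u = moore_penrose T b\<close> one has \<^term>\<open>T u = b\<close>, so complementarity gives
  \<^term>\<open>T x \<bullet> x = - (T u \<bullet> x)\<close>, and the Cauchy-Schwarz inequality for the form bounds the
  right-hand side by \<^term>\<open>M * norm u * norm x\<close>, where \<^term>\<open>M\<close> is \<^term>\<open>numrange_Sup T\<close>.\<close>

section \<open>Riesz representation and adjoints on a Hilbert space\<close>

text \<open>The representing vector is a minimiser of the functional \<open>J\<close>: a minimising
  sequence converges by completeness, and the vanishing of the first variation at its limit is the
  claimed identity.\<close>

lemma riesz_representation:
  fixes f :: "'a::{real_inner, complete_space} \<Rightarrow> real"
  assumes "bounded_linear f"
  shows "\<exists>z. \<forall>y. f y = z \<bullet> y"
proof -
  interpret f: bounded_linear f by fact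
  define J where "J y = y \<bullet> y - 2 * f y" for y
  obtain C where C: "\<And>y. norm (f y) \<le> norm y * C"
    using f.bounded by blast
  have J_ge: "- (C\<^sup>2) \<le> J y" for y
  proof -
    have "2 * f y \<le> 2 * (norm y * C)" using C[of y] by simp
    also have "\<dots> \<le> (norm y)\<^sup>2 + C\<^sup>2"
      using sum_squares_bound[of "norm y" C] by simp
    finally show ?thesis by (simp add: J_def power2_norm_eq_inner)
  qed
  have bdd: "bdd_below (range J)" using J_ge by (auto intro!: bdd_belowI)
  define d where "d = (INF y. J y)"
  have d_le: "d \<le> J y" for y unfolding d_def by (rule cINF_lower[OF bdd]) simp
  have "\<exists>y. J y < d + inverse (real (Suc n))" for n
    using cINF_less_iff[OF _ bdd, of "d + inverse (real (Suc n))"] by (auto simp: d_def)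
  then obtain y where y: "\<And>n. J (y n) < d + inverse (real (Suc n))" by metis
  \<comment> \<open>Parallelogram law: \<open>J\<close> is at least \<open>d\<close> at the
    midpoint, so two near-minimisers are close to each other.\<close>
  have mid: "(norm (u - v))\<^sup>2 \<le> 2 * J u + 2 * J v - 4 * d" for u v
  proof -
    define w where "w = (1/2) *\<^sub>R (u + v)"
    have "(norm (u - v))\<^sup>2 = 2 * J u + 2 * J v - 4 * J w"
      by (simp add: w_def J_def power2_norm_eq_inner f.scaleR f.add algebra_simps inner_commute)
    then show ?thesis using d_le[of w] by linarith
  qed
  have "Cauchy y"
  proof (rule metric_CauchyI)
    fix e :: real assume e: "0 < e"
    obtain M where M: "inverse (real (Suc M)) < e\<^sup>2 / 4"
      using reals_Archimedean[of "e\<^sup>2 / 4"] e by (meson divide_pos_pos zero_less_numeral zero_less_power)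
    have "dist (y i) (y j) < e" if "i \<ge> M" "j \<ge> M" for i j
    proof -
      have "inverse (real (Suc i)) \<le> inverse (real (Suc M))"
        "inverse (real (Suc j)) \<le> inverse (real (Suc M))"
        using that by (auto intro!: le_imp_inverse_le)
      then have "(norm (y i - y j))\<^sup>2 < e\<^sup>2"
        using mid[of "y i" "y j"] y[of i] y[of j] M by linarith
      then show ?thesis unfolding dist_norm by (rule power2_less_imp_less) (use e in simp)
    qed
    then show "\<exists>M. \<forall>m\<ge>M. \<forall>n\<ge>M. dist (y m) (y n) < e" by blast
  qed
  then obtain z where z: "y \<longlonglongrightarrow> z" by (auto simp: Cauchy_convergent_iff convergent_def)
  have "(\<lambda>n. J (y n)) \<longlonglongrightarrow> J z"
    unfolding J_def by (intro tendsto_intros z f.tendsto)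
  moreover have "(\<lambda>n. d + inverse (real (Suc n))) \<longlonglongrightarrow> d + 0"
    by (intro tendsto_intros LIMSEQ_inverse_real_of_nat)
  ultimately have "J z \<le> d + 0"
    by (rule LIMSEQ_le) (use y less_imp_le in blast)
  then have min: "J z \<le> J u" for u using d_le[of u] by linarith
  have "f u = z \<bullet> u" for u
  proof (cases "u = 0")
    case False
    define c where "c = z \<bullet> u - f u"
    \<comment> \<open>The minimiser of \<open>J (z + t *\<^sub>R u)\<close> over t, which would
      undercut \<open>J z\<close> if \<open>c\<close> were nonzero.\<close>
    define t where "t = - c / (u \<bullet> u)"
    have uu: "u \<bullet> u > 0" using False by simp
    have "J (z + t *\<^sub>R u) = J z + 2 * t * c + t\<^sup>2 * (u \<bullet> u)"
      by (simp add: J_def c_def f.scaleR f.add algebra_simps inner_commute power2_eq_square)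
    also have "\<dots> = J z - c\<^sup>2 / (u \<bullet> u)"
      using uu by (simp add: t_def power2_eq_square field_simps)
    finally have "c\<^sup>2 / (u \<bullet> u) \<le> 0" using min[of "z + t *\<^sub>R u"] by linarith
    then have "c\<^sup>2 \<le> 0" using uu by (simp add: divide_le_0_iff)
    then show ?thesis by (simp add: c_def)
  qed (simp add: f.zero)
  then show ?thesis by blast
qed

text \<open>\<^term>\<open>adjoint f\<close> is a choice term, so this is also what gives content to the equations
  for adjoints in the definition of the Moore-Penrose inverse.\<close>

lemma inner_adjoint:
  fixes f :: "'a::{real_inner, complete_space} \<Rightarrow> 'b::real_inner"
  assumes "bounded_linear f"
  shows "f x \<bullet> y = x \<bullet> adjoint f y"
proof -
  have "\<exists>z. \<forall>x. f x \<bullet> y = z \<bullet> x" for y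
    by (rule riesz_representation) (intro bounded_linear_inner_left_comp assms)
  then obtain g where "\<And>y x. f x \<bullet> y = g y \<bullet> x" by metis
  then have "\<forall>x y. f x \<bullet> y = x \<bullet> g y" by (simp add: inner_commute)
  then have "adjoint f = g" "f x \<bullet> y = x \<bullet> g y" by (auto intro: adjoint_unique)
  then show ?thesis by simp
qed

section \<open>Uniqueness of the Moore-Penrose inverse\<close>

text \<open>\<open>T \<circ> R\<close> and \<open>T \<circ> S\<close> are symmetric projections with
  the same range, \<open>R \<circ> T\<close> and \<open>S \<circ> T\<close> symmetric projections
  with the same kernel, so each pair coincides. Then R = RTR = STS = S.\<close>

lemma is_moore_penrose_unique:
  fixes T :: "'a::{real_inner, complete_space} \<Rightarrow> 'a"
  assumes T: "bounded_linear T" and R: "is_moore_penrose T R" and S: "is_moore_penrose T S"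
  shows "R = S"
proof -
  have sym: "T (Q x) \<bullet> y = x \<bullet> T (Q y)" "Q (T x) \<bullet> y = x \<bullet> Q (T y)"
    and TQT: "T (Q (T x)) = T x" and QTQ: "Q (T (Q x)) = Q x"
    if "is_moore_penrose T Q" for Q x y
  proof -
    have Q: "bounded_linear Q" "T \<circ> Q \<circ> T = T" "Q \<circ> T \<circ> Q = Q"
      "adjoint (T \<circ> Q) = T \<circ> Q" "adjoint (Q \<circ> T) = Q \<circ> T"
      using that by (auto simp: is_moore_penrose_def)
    have "bounded_linear (T \<circ> Q)" "bounded_linear (Q \<circ> T)"
      using T Q(1) bounded_linear_compose by (auto simp: comp_def)
    note * = this[THEN inner_adjoint, of x y]
    show "T (Q x) \<bullet> y = x \<bullet> T (Q y)" using *(1) unfolding Q(4) by simp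
    show "Q (T x) \<bullet> y = x \<bullet> Q (T y)" using *(2) unfolding Q(5) by simp
    show "T (Q (T x)) = T x" using fun_cong[OF Q(2), of x] by simp
    show "Q (T (Q x)) = Q x" using fun_cong[OF Q(3), of x] by simp
  qed
  have TR_TS: "T (R x) = T (S x)" for x
  proof -
    have "T (R x) \<bullet> y = T (S x) \<bullet> y" for y
    proof -
      have "T (R x) \<bullet> y = T (S (T (R x))) \<bullet> y" by (simp only: TQT[OF S])
      also have "\<dots> = x \<bullet> T (R (T (S y)))" by (simp only: sym(1)[OF S] sym(1)[OF R])
      also have "\<dots> = T (S x) \<bullet> y" by (simp only: TQT[OF R] sym(1)[OF S])
      finally show ?thesis .
    qed
    then show ?thesis using vector_eq_rdot by blast
  qed
  have RT_ST: "R (T x) = S (T x)" for x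
  proof -
    have "R (T x) \<bullet> y = S (T x) \<bullet> y" for y
    proof -
      have "R (T x) \<bullet> y = R (T (S (T x))) \<bullet> y" by (simp only: TQT[OF S])
      also have "\<dots> = x \<bullet> S (T (R (T y)))" by (simp only: sym(2)[OF S] sym(2)[OF R])
      also have "\<dots> = S (T x) \<bullet> y" by (simp only: TQT[OF R] sym(2)[OF S])
      finally show ?thesis .
    qed
    then show ?thesis using vector_eq_rdot by blast
  qed
  show ?thesis
  proof
    fix x
    have "R x = R (T (R x))" by (rule QTQ[OF R, symmetric])
    also have "\<dots> = S (T (S x))" by (simp only: RT_ST TR_TS)
    also have "\<dots> = S x" by (rule QTQ[OF S])
    finally show "R x = S x" .
  qed
qed

section \<open>Symmetric operators, semidefinite forms and closures of subspaces\<close>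

lemma symmetric_imp_adjoint_eq:
  fixes f :: "'a::real_inner \<Rightarrow> 'a"
  assumes "\<And>x y. f x \<bullet> y = x \<bullet> f y"
  shows "adjoint f = f"
  using assms by (intro adjoint_unique) blast

lemma psd_Cauchy_Schwarz:
  fixes T :: "'a::real_inner \<Rightarrow> 'a"
  assumes lin: "linear T" and sym: "\<And>x y. T x \<bullet> y = x \<bullet> T y" and psd: "\<And>x. 0 \<le> T x \<bullet> x"
  shows "(T x \<bullet> y)\<^sup>2 \<le> (T x \<bullet> x) * (T y \<bullet> y)"
proof -
  interpret linear T by fact
  define p q r where "p = T x \<bullet> x" and "q = T y \<bullet> y" and "r = T x \<bullet> y"
  have quad: "0 \<le> s\<^sup>2 * p + 2 * s * t * r + t\<^sup>2 * q" for s t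
  proof -
    have "T (s *\<^sub>R x + t *\<^sub>R y) \<bullet> (s *\<^sub>R x + t *\<^sub>R y) = s\<^sup>2 * p + 2 * s * t * r + t\<^sup>2 * q"
      unfolding p_def q_def r_def using sym[of y x]
      by (simp add: add scaleR inner_add_left inner_add_right power2_eq_square algebra_simps
          inner_commute)
    then show ?thesis using psd[of "s *\<^sub>R x + t *\<^sub>R y"] by simp
  qed
  have p: "0 \<le> p" and q: "0 \<le> q" using psd by (auto simp: p_def q_def)
  have "r\<^sup>2 \<le> p * q"
  proof (cases "p = 0")
    case True
    \<comment> \<open>With \<open>p = 0\<close> the form is affine in s for fixed t; at s = -(q +
      1), t = r it equals -(q + 2) r^2, which forces \<open>r = 0\<close>.\<close>
    have "2 * r * (- (q + 1) * r) + r\<^sup>2 * q = - (q + 2) * r\<^sup>2"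
      by (simp add: power2_eq_square algebra_simps)
    then have "0 \<le> - (q + 2) * r\<^sup>2"
      using quad[of "- (q + 1)" r] True by (simp add: power2_eq_square algebra_simps)
    then have "r\<^sup>2 \<le> 0" using q by (simp add: zero_le_mult_iff)
    then show ?thesis using True by simp
  next
    case False
    \<comment> \<open>The form evaluated at \<open>p *\<^sub>R y - r *\<^sub>R x\<close>, a multiple
      of the component of y that is form-orthogonal to x.\<close>
    have "0 \<le> p * (p * q - r\<^sup>2)"
      using quad[of "- r" p] by (simp add: power2_eq_square algebra_simps)
    then show ?thesis using False p by (simp add: zero_le_mult_iff)
  qed
  then show ?thesis by (simp add: p_def q_def r_def)
qed

lemma subspace_closure:
  fixes S :: "'a::real_normed_vector set"
  assumes S: "subspace S"
  shows "subspace (closure S)"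
proof (rule subspaceI)
  show "0 \<in> closure S" using subspace_0[OF S] closure_subset by blast
next
  fix x y assume "x \<in> closure S" "y \<in> closure S"
  then obtain f g where "\<And>n. f n \<in> S" "f \<longlonglongrightarrow> x" "\<And>n. g n \<in> S" "g \<longlonglongrightarrow> y"
    by (auto simp: closure_sequential)
  then have "\<forall>n. f n + g n \<in> S" "(\<lambda>n. f n + g n) \<longlonglongrightarrow> x + y"
    by (simp_all add: subspace_add[OF S] tendsto_add)
  then show "x + y \<in> closure S"
    unfolding closure_sequential by (intro exI[of _ "\<lambda>n. f n + g n"] conjI)
next
  fix c x assume "x \<in> closure S"
  then obtain f where "\<And>n. f n \<in> S" "f \<longlonglongrightarrow> x"
    by (auto simp: closure_sequential)
  then have "\<forall>n. c *\<^sub>R f n \<in> S" "(\<lambda>n. c *\<^sub>R f n) \<longlonglongrightarrow> c *\<^sub>R x"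
    by (simp_all add: subspace_scale[OF S] tendsto_scaleR)
  then show "c *\<^sub>R x \<in> closure S"
    unfolding closure_sequential by (intro exI[of _ "\<lambda>n. c *\<^sub>R f n"] conjI)
qed

section \<open>Symmetric operators that are coercive on their range\<close>

locale coercive_on_range = bounded_linear T
  for T :: "'a::{real_inner, complete_space} \<Rightarrow> 'a" +
  fixes m :: real
  assumes sym: "T x \<bullet> y = x \<bullet> T y"
    and m_pos: "0 < m"
    and coercive_range: "v \<in> range T \<Longrightarrow> m * (v \<bullet> v) \<le> T v \<bullet> v"
begin

text \<open>The range is not assumed closed; its closure is complete, as the fixed-point argument
  requires, and inherits coercivity by continuity.\<close>

abbreviation "V \<equiv> closure (range T)"

lemma subspace_V: "subspace V"
  by (intro subspace_closure linear_subspace_image linear_axioms subspace_UNIV)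

lemma coercive:
  assumes "v \<in> V" shows "m * (v \<bullet> v) \<le> T v \<bullet> v"
proof -
  have "closed {v. m * (v \<bullet> v) \<le> T v \<bullet> v}"
    by (intro closed_Collect_le continuous_intros continuous_on)
  then have "V \<subseteq> {v. m * (v \<bullet> v) \<le> T v \<bullet> v}"
    using coercive_range by (intro closure_minimal) auto
  then show ?thesis using assms by auto
qed

lemma norm_ge:
  assumes "v \<in> V" shows "m * norm v \<le> norm (T v)"
proof (cases "v = 0")
  case False
  have "m * norm v * norm v \<le> norm (T v) * norm v"
    using coercive[OF assms] norm_cauchy_schwarz[of "T v" v]
    by (simp add: dot_square_norm power2_eq_square mult.assoc)
  then show ?thesis using False by simp
qed simp

text \<open>By symmetry \<open>T (T w) \<bullet> w\<close> is the squared norm of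
  \<open>T w\<close>. This strips one \<open>T\<close> from normal equations.\<close>

lemma T_T_eq_0D:
  assumes "T (T w) = 0" shows "T w = 0"
  using sym[of "T w" w] assms by (simp add: inner_commute)

text \<open>The map \<^term>\<open>\<lambda>v. v - t *\<^sub>R T (T v - y)\<close> preserves \<^term>\<open>V\<close> and contracts it for
  small \<^term>\<open>t > 0\<close>. Its fixed points solve the normal equation, so no orthogonal
  projection is needed.\<close>

lemma normal_equation: "\<exists>!v. v \<in> V \<and> T (T v) = T y"
proof (rule ex_ex1I)
  obtain C0 where C0: "\<And>v. norm (T v) \<le> norm v * C0" using bounded by blast
  \<comment> \<open>Taking the maximum with \<open>m\<close> makes \<open>C\<close> positive and
    keeps m^4 / C^4 at most 1.\<close>
  define C where "C = max C0 m"
  have C: "norm (T v) \<le> C * norm v" for v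
    using C0[of v] mult_left_mono[of C0 C "norm v"] by (simp add: C_def mult.commute)
  have Cm: "m \<le> C" and C_pos: "0 < C" using m_pos by (auto simp: C_def)
  \<comment> \<open>This \<open>t\<close> minimises the bound 1 - 2 t m^2 + t^2 C^4 on the squared
    contraction factor; the minimum is c^2.\<close>
  define t where "t = m\<^sup>2 / C ^ 4"
  define c where "c = sqrt (1 - m ^ 4 / C ^ 4)"
  have "m ^ 4 \<le> C ^ 4" using Cm m_pos by (intro power_mono) auto
  then have q: "0 \<le> 1 - m ^ 4 / C ^ 4" "1 - m ^ 4 / C ^ 4 < 1"
    using C_pos m_pos by (auto simp: field_simps)
  have t_pos: "0 < t" using m_pos C_pos by (simp add: t_def)
  define g where "g v = v - t *\<^sub>R T (T v - y)" for v
  have g_V: "g v \<in> V" if "v \<in> V" for v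
    unfolding g_def using that closure_subset[of "range T"]
    by (intro subspace_diff subspace_scale subspace_V) auto
  have contr: "dist (g u) (g v) \<le> c * dist u v" if "u \<in> V" "v \<in> V" for u v
  proof -
    define w where "w = u - v"
    have w: "w \<in> V" unfolding w_def using that by (intro subspace_diff subspace_V)
    have "m * norm w \<le> norm (T w)" by (rule norm_ge[OF w])
    then have lo: "m\<^sup>2 * (norm w)\<^sup>2 \<le> (norm (T w))\<^sup>2"
      using m_pos power_mono[of "m * norm w" "norm (T w)" 2] by (simp add: power_mult_distrib)
    have "norm (T (T w)) \<le> C * (C * norm w)"
      using C[of "T w"] C[of w] C_pos by (meson mult_left_mono order_trans less_imp_le)
    then have "(norm (T (T w)))\<^sup>2 \<le> (C * (C * norm w))\<^sup>2" by (intro power_mono) auto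
    then have hi: "(norm (T (T w)))\<^sup>2 \<le> C ^ 4 * (norm w)\<^sup>2"
      by (simp add: power_mult_distrib flip: power_mult power_add mult.assoc)
    have guv: "g u - g v = w - t *\<^sub>R T (T w)"
      by (simp add: g_def w_def diff algebra_simps)
    have "(norm (g u - g v))\<^sup>2 = (norm w)\<^sup>2 - 2 * t * (T (T w) \<bullet> w) + t\<^sup>2 * (norm (T (T w)))\<^sup>2"
      unfolding guv power2_norm_eq_inner
      by (simp add: inner_diff_left inner_diff_right inner_commute power2_eq_square)
    also have "T (T w) \<bullet> w = (norm (T w))\<^sup>2" by (simp add: sym power2_norm_eq_inner)
    also have "(norm w)\<^sup>2 - 2 * t * (norm (T w))\<^sup>2 + t\<^sup>2 * (norm (T (T w)))\<^sup>2
        \<le> (norm w)\<^sup>2 - 2 * t * (m\<^sup>2 * (norm w)\<^sup>2) + t\<^sup>2 * (C ^ 4 * (norm w)\<^sup>2)"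
      using lo hi t_pos by (intro add_mono diff_mono mult_left_mono) auto
    also have "\<dots> = (1 - m ^ 4 / C ^ 4) * (norm w)\<^sup>2"
      using C_pos by (simp add: t_def field_simps flip: power_add power_mult)
    also have "\<dots> = (c * norm w)\<^sup>2" using q by (simp add: c_def power_mult_distrib)
    finally show ?thesis unfolding dist_norm w_def[symmetric]
      by (rule power2_le_imp_le) (use q in \<open>simp add: c_def\<close>)
  qed
  have "\<exists>!v\<in>V. g v = v"
  proof (rule Banach_fix)
    show "complete V" by (simp add: complete_eq_closed)
    show "0 \<le> c" "c < 1" using q by (auto simp: c_def)
  qed (use g_V contr in auto)
  then obtain v where v: "v \<in> V" "g v = v" by blast
  have "t *\<^sub>R T (T v - y) = v - g v" by (simp add: g_def)
  then have "T (T v - y) = 0" using t_pos v(2) by simp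
  then have "T (T v) = T y" by (simp add: diff)
  then show "\<exists>v. v \<in> V \<and> T (T v) = T y" using v(1) by blast
next
  fix u v assume uv: "u \<in> V \<and> T (T u) = T y" "v \<in> V \<and> T (T v) = T y"
  have "T (u - v) = 0" by (rule T_T_eq_0D) (simp add: diff uv)
  moreover have "u - v \<in> V" using uv by (intro subspace_diff subspace_V) auto
  ultimately show "u = v" using norm_ge[of "u - v"] m_pos by (simp add: mult_le_0_iff)
qed

text \<open>The normal equation yields \<open>v\<close> in \<open>V\<close> with
  \<open>T v = T y\<close>. By symmetry the form has the same value at \<open>y\<close> and
  \<open>v\<close>, and coercivity applies at \<open>v\<close>.\<close>

lemma psd: "0 \<le> T y \<bullet> y"
proof -
  obtain v where v: "v \<in> V" "T (T v) = T (T y)" using normal_equation by blast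
  have "T (v - y) = 0" by (rule T_T_eq_0D) (simp add: diff v)
  then have Tv: "T v = T y" by (simp add: diff)
  then have "T y \<bullet> y = T v \<bullet> v" by (metis sym inner_commute)
  then show ?thesis using coercive[OF v(1)] m_pos
    by (metis inner_ge_zero less_imp_le mult_nonneg_nonneg order_trans)
qed

text \<open>The inverse sends y to the least-squares solution of \<open>T v = y\<close> lying in
  \<open>V\<close>. Both \<open>T \<circ> S\<close> and \<open>S \<circ> T\<close> are then the
  orthogonal projection onto \<open>V\<close>, hence symmetric.\<close>

lemma ex_moore_penrose: "\<exists>S. is_moore_penrose T S"
proof -
  define S where "S y = (THE v. v \<in> V \<and> T (T v) = T y)" for y
  have S: "S y \<in> V" "T (T (S y)) = T y" for y
    using theI'[OF normal_equation[of y]] by (auto simp: S_def)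
  have S_eq: "S y = v" if "v \<in> V" "T (T v) = T y" for v y
    using normal_equation[of y] S[of y] that by blast
  have TST: "T (S (T y)) = T y" for y
  proof -
    have "T (S (T y) - y) = 0" by (rule T_T_eq_0D) (simp add: diff S)
    then show ?thesis by (simp add: diff)
  qed
  have ST: "S (T v) = v" if "v \<in> V" for v using that by (intro S_eq) auto
  have orth: "w \<bullet> v = 0" if "T w = 0" "v \<in> V" for w v
  proof -
    have "closed {v. w \<bullet> v = 0}" by (intro closed_Collect_eq continuous_intros)
    moreover have "w \<bullet> T z = 0" for z using sym[of w z] that(1) by simp
    ultimately have "V \<subseteq> {v. w \<bullet> v = 0}" by (intro closure_minimal) auto
    then show ?thesis using that by auto
  qed
  have TS_sym: "T (S x) \<bullet> y = x \<bullet> T (S y)" for x y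
  proof -
    \<comment> \<open>\<open>x - T (S x)\<close> lies in the kernel of \<open>T\<close>, hence is
      orthogonal to \<open>V\<close>. The resulting expression is symmetric in x and y.\<close>
    have *: "x \<bullet> T (S y) = T (S x) \<bullet> T (S y)" for x y
      using orth[of "x - T (S x)" "T (S y)"] closure_subset[of "range T"]
      by (auto simp: diff S inner_diff_left)
    show ?thesis using *[of x y] *[of y x] by (simp add: inner_commute)
  qed
  have ST_sym: "S (T x) \<bullet> y = x \<bullet> S (T y)" for x y
  proof -
    have *: "x \<bullet> S (T y) = S (T x) \<bullet> S (T y)" for x y
      using orth[of "x - S (T x)" "S (T y)"] S(1) by (simp add: diff TST inner_diff_left)
    show ?thesis using *[of x y] *[of y x] by (simp add: inner_commute)
  qed
  have "bounded_linear S"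
  proof (rule bounded_linear_intro)
    show "S (x + y) = S x + S y" for x y
      by (rule S_eq) (auto intro: subspace_add[OF subspace_V] simp: S add)
    show "S (r *\<^sub>R x) = r *\<^sub>R S x" for r x
      by (rule S_eq) (auto intro: subspace_scale[OF subspace_V] simp: S scaleR)
    show "norm (S y) \<le> norm y * inverse m" for y
    proof -
      \<comment> \<open>By the normal equation; it shows that \<open>T \<circ> S\<close> does not
        increase norms, so \<open>norm_ge\<close> bounds \<open>S\<close> by 1/m.\<close>
      have "(norm (T (S y)))\<^sup>2 = y \<bullet> T (S y)"
        by (metis S(2) sym power2_norm_eq_inner)
      also have "\<dots> \<le> norm y * norm (T (S y))" by (rule norm_cauchy_schwarz)
      finally have "norm (T (S y)) \<le> norm y"
        by (cases "T (S y) = 0") (auto simp: power2_eq_square)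
      then have "m * norm (S y) \<le> norm y" using norm_ge[OF S(1)[of y]] by linarith
      then show ?thesis using m_pos by (simp add: field_simps)
    qed
  qed
  moreover have "adjoint (T \<circ> S) = T \<circ> S" "adjoint (S \<circ> T) = S \<circ> T"
    by (auto intro!: symmetric_imp_adjoint_eq simp: TS_sym ST_sym)
  ultimately have "is_moore_penrose T S"
    unfolding is_moore_penrose_def by (auto simp: fun_eq_iff TST ST S(1))
  then show ?thesis by blast
qed

text \<open>\<open>moore_penrose\<close> is a definite description, so existence and uniqueness
  together give access to its equations. This one says that it solves \<open>T u = b\<close> for b
  in the range.\<close>

lemma T_moore_penrose_T: "T (moore_penrose T (T c)) = T c"
proof -
  have "is_moore_penrose T (moore_penrose T)"
    unfolding moore_penrose_def
    using ex_moore_penrose is_moore_penrose_unique[OF bounded_linear_axioms] by (metis theI)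
  then show ?thesis by (auto simp: is_moore_penrose_def fun_eq_iff)
qed

lemma norm_le_of_inner_eq_0:
  assumes x: "x \<in> range T" and perp: "x \<bullet> (T x + T u) = 0"
    and M: "\<And>y. T y \<bullet> y \<le> M * (y \<bullet> y)"
  shows "m * norm x \<le> M * norm u"
proof (cases "x = 0 \<or> u = 0")
  case False
  then have nz: "0 < norm x" "0 < norm u" by auto
  \<comment> \<open>The sign of \<open>M\<close> is not assumed; it comes from semidefiniteness at
    the nonzero vector \<open>u\<close>.\<close>
  have "0 \<le> M * (u \<bullet> u)" using psd[of u] M[of u] by linarith
  moreover have "0 < u \<bullet> u" using nz by simp
  ultimately have M0: "0 \<le> M" by (simp add: zero_le_mult_iff)
  have lo: "m * (norm x)\<^sup>2 \<le> T x \<bullet> x"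
    using coercive_range[OF x] by (simp add: power2_norm_eq_inner)
  have "(T x \<bullet> u)\<^sup>2 \<le> (T x \<bullet> x) * (T u \<bullet> u)"
    by (intro psd_Cauchy_Schwarz linear_axioms sym psd)
  also have "\<dots> \<le> (M * (norm x)\<^sup>2) * (M * (norm u)\<^sup>2)"
    using M M0 psd by (intro mult_mono) (auto simp: power2_norm_eq_inner)
  also have "\<dots> = (M * norm x * norm u)\<^sup>2" by (simp add: power2_eq_square)
  finally have "\<bar>T x \<bullet> u\<bar>\<^sup>2 \<le> (M * norm x * norm u)\<^sup>2" by simp
  then have "\<bar>T x \<bullet> u\<bar> \<le> M * norm x * norm u"
    by (rule power2_le_imp_le) (use M0 in simp)
  moreover have "T x \<bullet> x = - (T x \<bullet> u)"
    using perp sym[of x x] sym[of x u] by (simp add: inner_add_right)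
  ultimately have "m * norm x * norm x \<le> M * norm u * norm x"
    using lo by (simp add: power2_eq_square algebra_simps)
  then show ?thesis using nz by simp
next
  case True
  then show ?thesis
  proof
    assume "x = 0"
    have "0 \<le> M * (u \<bullet> u)" using psd[of u] M[of u] by linarith
    then have "0 \<le> (M * norm u) * norm u" by (simp add: dot_square_norm power2_eq_square)
    then show ?thesis using \<open>x = 0\<close> by (cases "u = 0") (simp_all add: zero_le_mult_iff)
  next
    assume "u = 0"
    \<comment> \<open>With \<open>u = 0\<close> complementarity reads
      \<open>x \<bullet> T x = 0\<close>, and coercivity forces \<open>x = 0\<close>.\<close>
    then have "m * (x \<bullet> x) \<le> 0"
      using coercive_range[OF x] perp by (simp add: inner_commute zero)
    then have "x \<bullet> x \<le> 0" using m_pos by (simp add: mult_le_0_iff)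
    then have "x = 0" by (metis inner_gt_zero_iff not_le)
    then show ?thesis using \<open>u = 0\<close> by simp
  qed
qed

end

section \<open>From extended-real extrema over unit vectors to real quadratic bounds\<close>

lemma quadratic_form_scale:
  fixes T :: "'a::real_inner \<Rightarrow> 'a"
  assumes "linear T" and "y \<noteq> 0"
  shows "T y \<bullet> y = (T (y /\<^sub>R norm y) \<bullet> (y /\<^sub>R norm y)) * (y \<bullet> y)"
  using assms by (simp add: linear_scale dot_square_norm power2_eq_square field_simps)

theorem theorem4p3:
  fixes T :: "'a::{real_inner, complete_space} \<Rightarrow> 'a"
    and K :: "'a set"
    and b x :: 'a
  assumes "self_dual_cone K"
    and "bounded_linear T"
    and "adjoint T = T"
    and "numrange_Inf T > 0"
    and "b \<in> range T"
    and "x \<in> range T"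
    and "solves_LCP K T b x"
  shows "ereal (norm x) \<le> numrange_Sup T / numrange_Inf T * ereal (norm (moore_penrose T b))"
proof (cases "range T = {0}")
  case True
  \<comment> \<open>The infimum over the empty set is \<infinity>, and dividing by it gives 0 in the
    extended reals; since \<open>x = 0\<close>, both sides are 0.\<close>
  have "{x \<in> range (adjoint T). norm x = 1} = {}" using True assms(3) by auto
  then have "numrange_Inf T = \<infinity>"
    unfolding numrange_Inf_def by (simp only: image_empty Inf_empty top_ereal_def)
  moreover have "x = 0" using assms(6) True by auto
  ultimately show ?thesis by simp
next
  case False
  interpret bounded_linear T by fact
  obtain C where C: "\<And>y. norm (T y) \<le> norm y * C" using bounded by blast
  have sc: "y /\<^sub>R norm y \<in> range T" if "y \<in> range T" for y
    using that by (metis image_iff rangeI scaleR)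
  from False obtain w where w: "w \<in> range T" "w \<noteq> 0" 
    by (metis empty_iff rangeI subsetI subset_singletonD insertCI)
  \<comment> \<open>A unit vector in the range: the form at \<open>e\<close> keeps the infimum below
    \<infinity> and the supremum above -\<infinity>, so that both are real numbers.\<close>
  define e where "e = w /\<^sub>R norm w"
  have e: "e \<in> range T" "norm e = 1" using w sc by (auto simp: e_def)
  have bound: "\<bar>T y \<bullet> y\<bar> \<le> C" if "norm y = 1" for y
    using C[of y] Cauchy_Schwarz_ineq2[of "T y" y] that by simp
  have Inf_le: "numrange_Inf T \<le> ereal (T y \<bullet> y)" if "y \<in> range T" "norm y = 1" for y
    using that assms(3) unfolding numrange_Inf_def by (intro INF_lower) auto
  have Sup_ge: "ereal (T y \<bullet> y) \<le> numrange_Sup T" if "norm y = 1" for y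
    using that unfolding numrange_Sup_def by (intro SUP_upper) auto
  obtain m where m: "numrange_Inf T = ereal m" "0 < m"
    using assms(4) Inf_le[OF e] by (cases "numrange_Inf T") auto
  have "numrange_Sup T \<le> ereal C"
    unfolding numrange_Sup_def using bound by (intro SUP_least) (auto simp: abs_le_iff)
  then obtain M where M: "numrange_Sup T = ereal M"
    using Sup_ge[OF e(2)] by (cases "numrange_Sup T") auto
  interpret coercive_on_range T m
  proof
    show "T x \<bullet> y = x \<bullet> T y" for x y
      using inner_adjoint[OF assms(2)] assms(3) by metis
    show "m * (v \<bullet> v) \<le> T v \<bullet> v" if "v \<in> range T" for v
    proof (cases "v = 0")
      case False
      then show ?thesis
        using Inf_le[OF sc[OF that]] m quadratic_form_scale[OF linear_axioms False]
        by (auto intro!: mult_right_mono)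
    qed simp
  qed (use m in auto)
  have upper: "T y \<bullet> y \<le> M * (y \<bullet> y)" for y
  proof (cases "y = 0")
    case False
    then show ?thesis
      using Sup_ge[of "y /\<^sub>R norm y"] M quadratic_form_scale[OF linear_axioms False]
      by (auto intro!: mult_right_mono)
  qed simp
  have "T (moore_penrose T b) = b" using assms(5) T_moore_penrose_T by auto
  then have "x \<bullet> (T x + T (moore_penrose T b)) = 0"
    using assms(7) by (simp add: solves_LCP_def)
  then have "m * norm x \<le> M * norm (moore_penrose T b)"
    using norm_le_of_inner_eq_0 assms(6) upper by blast
  then show ?thesis using m M by (simp add: field_simps)
qed

end
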